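(* For every 0-1 polytope $P\subseteq\mathbb{R}^n$ and for every nonempty set $X\subseteq\mathrm{vert}(P)$, we have $$\mathrm{xc}(\mathrm{forb}(P,X))\le \mu(X)\,(\mathrm{xc}(P)+1).$$
   Context: $\mathrm{vert}(P)$ is the set of vertices of a polytope $P$. Polytopes are nonempty and rational. A 0-1 polytope is a polytope all of whose vertices lie in $\{0,1\}^n$. For $X\subseteq\mathrm{vert}(P)$, $\mathrm{forb}(P,X):=\mathrm{conv}(\mathrm{vert}(P)\setminus X)$, where $\mathrm{conv}$ denotes convex hull. An extended formulation of a polytope $P$ is a description by linear equations and inequalities of a polyhedron whose image under a linear map is $P$. The extension complexity $\mathrm{xc}(P)$ is the minimum number of inequalities in any extended formulation of $P$ (equations are not counted). Given $X\subseteq\{0,1\}^n$, a collection $\mathcal{F}$ of faces of the cube $[0,1]^n$ is called $X$-separating if $\{0,1\}^n\setminus X=\bigcup_{F\in\mathcal{F}}(F\cap\{0,1\}^n)$; $\mu(X)$ denotes the minimal cardinality of an $X$-separating collection. *)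

theory Defs
  imports "HOL-Analysis.Analysis"
begin

definition vert :: "(real^'n) set \<Rightarrow> (real^'n) set" where
  "vert P = {v. v extreme_point_of P}"

definition cube_points :: "(real^'n) set" where
  "cube_points = {x. \<forall>i. x $ i \<in> {0, 1}}"

definition zero_one_polytope :: "(real^'n) set \<Rightarrow> bool" where
  "zero_one_polytope P \<longleftrightarrow> polytope P \<and> P \<noteq> {} \<and> vert P \<subseteq> cube_points"

definition forb :: "(real^'n) set \<Rightarrow> (real^'n) set \<Rightarrow> (real^'n) set" where
  "forb P X = convex hull (vert P - X)"

text \<open>The number of variables of an extended formulation is existentially quantified, so it
  cannot be a type: a vector of \<open>\<real>\<^sup>m\<close> is a function on the naturals vanishing from \<open>m\<close> on.
  The following is the polyhedron in \<open>\<real>\<^sup>m\<close> described by the \<open>r\<close> inequalities \<open>A y \<le> b\<close>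
  and the \<open>q\<close> equations \<open>C y = d\<close>.\<close>

definition system_polyhedron ::
  "nat \<Rightarrow> nat \<Rightarrow> (nat \<Rightarrow> nat \<Rightarrow> real) \<Rightarrow> (nat \<Rightarrow> real) \<Rightarrow>
   nat \<Rightarrow> (nat \<Rightarrow> nat \<Rightarrow> real) \<Rightarrow> (nat \<Rightarrow> real) \<Rightarrow> (nat \<Rightarrow> real) set" where
  "system_polyhedron m r A b q C d =
     {y. (\<forall>j\<ge>m. y j = 0) \<and>
         (\<forall>i<r. (\<Sum>j<m. A i j * y j) \<le> b i) \<and>
         (\<forall>i<q. (\<Sum>j<m. C i j * y j) = d i)}"

text \<open>The linear map is given by the images \<open>T j\<close> of the unit vectors of \<open>\<real>\<^sup>m\<close>.\<close>

definition has_extended_formulation :: "(real^'n) set \<Rightarrow> nat \<Rightarrow> bool" where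
  "has_extended_formulation P r \<longleftrightarrow>
     (\<exists>m A b q C d (T :: nat \<Rightarrow> real^'n).
        (\<lambda>y. \<Sum>j<m. y j *\<^sub>R T j) ` system_polyhedron m r A b q C d = P)"

text \<open>Every polytope, including the empty one, is described by finitely many inequalities, so
  the minimum exists for polytopes. The empty polytope is described by the single equation
  \<open>0 = 1\<close>, so its extension complexity is \<open>0\<close>.\<close>

definition xc :: "(real^'n) set \<Rightarrow> nat" where
  "xc P = (LEAST r. has_extended_formulation P r)"

definition separating :: "(real^'n) set \<Rightarrow> (real^'n) set set \<Rightarrow> bool" where
  "separating X \<F> \<longleftrightarrow>
     (\<forall>F\<in>\<F>. F face_of cbox 0 1) \<and> cube_points - X = (\<Union>F\<in>\<F>. F \<inter> cube_points)"

text \<open>The minimum exists, since the singletons of the points of \<open>cube_points - X\<close> form a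
  separating collection. Finiteness only excludes the junk value of \<^const>\<open>card\<close>: the cube
  has finitely many faces.\<close>

definition sep_number :: "(real^'n) set \<Rightarrow> nat" where
  "sep_number X = (LEAST k. \<exists>\<F>. finite \<F> \<and> separating X \<F> \<and> card \<F> = k)"

end

theory Submission
  imports Defs
begin

text \<open>The points of \<open>vert P - X\<close> are covered by the faces \<open>F \<inter> P\<close> of \<open>P\<close>, where \<open>F\<close>
  ranges over a minimal separating collection. Each \<open>F \<inter> P\<close> is \<open>P\<close> cut by an affine subspace,
  which only costs equations. Hence \<open>forb P X\<close> is the convex hull of the union of at most
  \<open>sep_number X\<close> polytopes of extension complexity at most \<open>xc P\<close>, and Balas' disjunctive
  formulation, which homogenizes each system with a multiplier \<open>\<lambda> \<ge> 0\<close>, adds one inequality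
  for each of them.\<close>

section \<open>Extended formulations over arbitrary finite index sets\<close>

text \<open>Enumerating the index sets turns such a system into one indexed by naturals. This lets
  later formulations use points or pairs as indices, and only \<open>card I\<close> is
  counted.\<close>

lemma has_extended_formulationI:
  fixes P :: "(real^'n) set" and T :: "'j \<Rightarrow> real^'n"
    and A :: "'i \<Rightarrow> 'j \<Rightarrow> real" and C :: "'k \<Rightarrow> 'j \<Rightarrow> real"
  assumes "finite J" "finite I" "finite K"
    and P: "P = {\<Sum>j\<in>J. y j *\<^sub>R T j | y.
      (\<forall>i\<in>I. (\<Sum>j\<in>J. A i j * y j) \<le> b i) \<and> (\<forall>k\<in>K. (\<Sum>j\<in>J. C k j * y j) = d k)}"
  shows "has_extended_formulation P (card I)"
proof -
  obtain f where f: "bij_betw f {..<card J} J"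
    using ex_bij_betw_nat_finite[OF \<open>finite J\<close>] by (auto simp: atLeast0LessThan)
  obtain g where g: "bij_betw g {..<card I} I"
    using ex_bij_betw_nat_finite[OF \<open>finite I\<close>] by (auto simp: atLeast0LessThan)
  obtain h where h: "bij_betw h {..<card K} K"
    using ex_bij_betw_nat_finite[OF \<open>finite K\<close>] by (auto simp: atLeast0LessThan)
  have ballI: "(\<forall>i\<in>I. Q i) \<longleftrightarrow> (\<forall>i<card I. Q (g i))" for Q
    using bij_betw_imp_surj_on[OF g] by (metis image_iff lessThan_iff)
  have ballK: "(\<forall>k\<in>K. Q k) \<longleftrightarrow> (\<forall>k<card K. Q (h k))" for Q
    using bij_betw_imp_surj_on[OF h] by (metis image_iff lessThan_iff)
  have sumJ: "(\<Sum>j\<in>J. F j) = (\<Sum>j<card J. F (f j))" for F :: "'j \<Rightarrow> 'z::comm_monoid_add"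
    by (rule sum.reindex_bij_betw[OF f, symmetric])
  let ?S = "system_polyhedron (card J) (card I) (\<lambda>i j. A (g i) (f j)) (\<lambda>i. b (g i))
              (card K) (\<lambda>k j. C (h k) (f j)) (\<lambda>k. d (h k))"
  have "(\<lambda>y. \<Sum>j<card J. y j *\<^sub>R T (f j)) ` ?S = P"
  proof (intro equalityI subsetI)
    fix x assume "x \<in> (\<lambda>y. \<Sum>j<card J. y j *\<^sub>R T (f j)) ` ?S"
    then obtain y where y: "y \<in> ?S" and x: "x = (\<Sum>j<card J. y j *\<^sub>R T (f j))" by auto
    \<comment> \<open>Values of \<open>z\<close> outside \<open>J\<close> are arbitrary, which is
      harmless since every sum runs over \<open>J\<close>.\<close>
    define z where "z j = y (the_inv_into {..<card J} f j)" for j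
    have z: "z (f j) = y j" if "j < card J" for j
      using that f by (simp add: z_def the_inv_into_f_f bij_betw_def)
    have "x = (\<Sum>j\<in>J. z j *\<^sub>R T j)"
      by (simp add: sumJ x z)
    moreover have "\<forall>i\<in>I. (\<Sum>j\<in>J. A i j * z j) \<le> b i" "\<forall>k\<in>K. (\<Sum>j\<in>J. C k j * z j) = d k"
      using y by (simp_all add: ballI ballK sumJ z system_polyhedron_def)
    ultimately show "x \<in> P"
      unfolding P by (intro CollectI exI[of _ z] conjI)
  next
    fix x assume "x \<in> P"
    then obtain y where x: "x = (\<Sum>j\<in>J. y j *\<^sub>R T j)"
      and y: "\<forall>i\<in>I. (\<Sum>j\<in>J. A i j * y j) \<le> b i" "\<forall>k\<in>K. (\<Sum>j\<in>J. C k j * y j) = d k"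
      unfolding P by blast
    \<comment> \<open>Padding by zeros places the solution in \<open>system_polyhedron\<close>,
      whose vectors vanish from \<open>card J\<close> on.\<close>
    define z where "z j = (if j < card J then y (f j) else 0)" for j
    have "z \<in> ?S"
      using y by (simp add: ballI ballK sumJ z_def system_polyhedron_def)
    moreover have "x = (\<Sum>j<card J. z j *\<^sub>R T (f j))"
      by (simp add: x sumJ z_def)
    ultimately show "x \<in> (\<lambda>y. \<Sum>j<card J. y j *\<^sub>R T (f j)) ` ?S"
      by (intro image_eqI[where x = z])
  qed
  then show ?thesis unfolding has_extended_formulation_def by (intro exI)
qed

lemma has_extended_formulationE:
  fixes P :: "(real^'n) set"
  assumes "has_extended_formulation P r"
  obtains m A b C d and q :: nat and T :: "nat \<Rightarrow> real^'n" where
    "P = {\<Sum>j<m. y j *\<^sub>R T j | y.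
      (\<forall>i<r. (\<Sum>j<m. A i j * y j) \<le> b i) \<and> (\<forall>k<q. (\<Sum>j<m. C k j * y j) = d k)}"
proof -
  obtain m A b C d and q :: nat and T :: "nat \<Rightarrow> real^'n" where
    P: "(\<lambda>y. \<Sum>j<m. y j *\<^sub>R T j) ` system_polyhedron m r A b q C d = P"
    using assms unfolding has_extended_formulation_def by blast
  have "P = {\<Sum>j<m. y j *\<^sub>R T j | y.
      (\<forall>i<r. (\<Sum>j<m. A i j * y j) \<le> b i) \<and> (\<forall>k<q. (\<Sum>j<m. C k j * y j) = d k)}" (is "P = ?R")
  proof
    show "P \<subseteq> ?R" unfolding P[symmetric] system_polyhedron_def by blast
    show "?R \<subseteq> P"
    proof
      fix x assume "x \<in> ?R"
      then obtain y where x: "x = (\<Sum>j<m. y j *\<^sub>R T j)"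
        and y: "\<forall>i<r. (\<Sum>j<m. A i j * y j) \<le> b i" "\<forall>k<q. (\<Sum>j<m. C k j * y j) = d k"
        by blast
      define z where "z j = (if j < m then y j else 0)" for j
      have "z \<in> system_polyhedron m r A b q C d"
        using y by (simp add: z_def system_polyhedron_def)
      moreover have "x = (\<Sum>j<m. z j *\<^sub>R T j)"
        by (simp add: x z_def)
      ultimately show "x \<in> P" unfolding P[symmetric] by blast
    qed
  qed
  then show ?thesis by (rule that)
qed

section \<open>Existence of extended formulations\<close>

text \<open>Covers the union of no sets below, which occurs when \<open>X\<close> contains every
  vertex of \<open>P\<close>.\<close>

lemma has_extended_formulation_empty: "has_extended_formulation ({} :: (real^'n) set) 0"
proof -
  have "has_extended_formulation ({} :: (real^'n) set) (card ({} :: nat set))"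
    by (rule has_extended_formulationI[where J = "{}" and K = "{0}"
          and b = "\<lambda>_. 0" and d = "\<lambda>_::nat. 1" and A = "\<lambda>_ _. 0" and C = "\<lambda>_ _. 0"
          and T = "\<lambda>_. 0"]) auto
  then show ?thesis by simp
qed

text \<open>A polytope is the linear image of a simplex: the variables are the coefficients of a
  convex combination of \<open>V\<close>. The crude bound \<open>card V\<close> suffices, as it only
  serves to show that the minimum in \<open>xc\<close> is attained.\<close>

lemma polytope_has_extended_formulation:
  fixes P :: "(real^'n) set"
  assumes "polytope P"
  shows "\<exists>r. has_extended_formulation P r"
proof -
  obtain V where V: "finite V" "P = convex hull V"
    using assms unfolding polytope_def by blast
  have neg: "(\<Sum>j\<in>V. (if i = j then - 1 else 0) * y j) = - y i"
    if "i \<in> V" for i and y :: "real^'n \<Rightarrow> real"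
    using V(1) that by (simp add: if_distrib[of "\<lambda>c. c * _"] cong: if_cong)
  have "has_extended_formulation P (card V)"
  proof (rule has_extended_formulationI[where J = V and K = "{()}" and T = "\<lambda>v. v"
          and A = "\<lambda>i j. if i = j then - 1 else 0" and b = "\<lambda>_. 0"
          and C = "\<lambda>_ _. 1" and d = "\<lambda>_. 1"])
    show "P = {\<Sum>j\<in>V. y j *\<^sub>R j |y.
      (\<forall>i\<in>V. (\<Sum>j\<in>V. (if i = j then - 1 else 0) * y j) \<le> 0) \<and>
      (\<forall>k\<in>{()}. (\<Sum>j\<in>V. 1 * y j) = 1)}"
      unfolding V(2) convex_hull_finite[OF V(1)] by (auto simp: neg)
  qed (use V in auto)
  then show ?thesis by blast
qed

section \<open>Intersection with affine subspaces\<close>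

lemma has_extended_formulation_Int_hyperplane:
  fixes P :: "(real^'n) set"
  assumes "has_extended_formulation P r"
  shows "has_extended_formulation (P \<inter> {x. a \<bullet> x = \<beta>}) r"
proof -
  obtain m A b C d and q :: nat and T :: "nat \<Rightarrow> real^'n" where
    P: "P = {\<Sum>j<m. y j *\<^sub>R T j | y.
      (\<forall>i<r. (\<Sum>j<m. A i j * y j) \<le> b i) \<and> (\<forall>k<q. (\<Sum>j<m. C k j * y j) = d k)}"
    using assms by (rule has_extended_formulationE)
  \<comment> \<open>The hyperplane is pulled back along the linear map \<open>T\<close>; its
    equation takes the first free index \<open>q\<close>.\<close>
  define C' where "C' k j = (if k = q then a \<bullet> T j else C k j)" for k j
  define d' where "d' k = (if k = q then \<beta> else d k)" for k
  have a: "a \<bullet> (\<Sum>j<m. y j *\<^sub>R T j) = (\<Sum>j<m. C' q j * y j)" for y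
    by (simp add: inner_sum_right C'_def mult.commute)
  have eqs: "(\<forall>k\<in>{..q}. (\<Sum>j<m. C' k j * y j) = d' k) \<longleftrightarrow>
    (\<forall>k<q. (\<Sum>j<m. C k j * y j) = d k) \<and> a \<bullet> (\<Sum>j<m. y j *\<^sub>R T j) = \<beta>" for y
    unfolding a by (auto simp: C'_def d'_def le_less)
  have "has_extended_formulation (P \<inter> {x. a \<bullet> x = \<beta>}) (card {..<r})"
    by (rule has_extended_formulationI[where J = "{..<m}" and K = "{..q}" and T = T
          and A = A and b = b and C = C' and d = d'])
      (use P eqs in auto)
  then show ?thesis by simp
qed

text \<open>An affine hull is a finite intersection of hyperplanes, each of which costs one equation
  and no inequality.\<close>

lemma has_extended_formulation_Int_affine_hull:
  fixes P S :: "(real^'n) set"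
  assumes "has_extended_formulation P r"
  shows "has_extended_formulation (P \<inter> affine hull S) r"
proof -
  obtain \<H> where \<H>: "finite \<H>" "affine hull S = \<Inter>\<H>"
    "\<And>h. h \<in> \<H> \<Longrightarrow> \<exists>a b. a \<noteq> 0 \<and> h = {x. a \<bullet> x = b}"
    using affine_hull_finite_intersection_hyperplanes[of S] by metis
  have "has_extended_formulation (P \<inter> \<Inter>\<G>) r" if "finite \<G>" "\<G> \<subseteq> \<H>" for \<G>
    using that
  proof (induction \<G>)
    case empty
    then show ?case using assms by simp
  next
    case (insert h \<G>)
    obtain a b where "h = {x. a \<bullet> x = b}" using \<H>(3) insert.prems by blast
    then have "P \<inter> \<Inter>(insert h \<G>) = P \<inter> \<Inter>\<G> \<inter> {x. a \<bullet> x = b}" by auto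
    then show ?case
      using insert has_extended_formulation_Int_hyperplane by simp
  qed
  then show ?thesis using \<H> by simp
qed

section \<open>Balas' disjunctive formulation\<close>

lemma bounded_ray_imp_zero:
  fixes v :: "'a::real_normed_vector"
  assumes "bounded S" and ray: "\<And>t. t \<ge> 0 \<Longrightarrow> u + t *\<^sub>R v \<in> S"
  shows "v = 0"
proof (rule ccontr)
  assume "v \<noteq> 0"
  obtain B where B: "\<And>x. x \<in> S \<Longrightarrow> norm x \<le> B"
    using \<open>bounded S\<close> by (auto simp: bounded_iff)
  \<comment> \<open>Chosen so that \<open>t *\<^sub>R v\<close> is longer than
    \<open>\<bar>B\<bar> + norm u\<close>, which takes \<open>u + t *\<^sub>R v\<close> out of the
    ball of radius \<open>B\<close>.\<close>
  define t where "t = (\<bar>B\<bar> + norm u + 1) / norm v"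
  have "t \<ge> 0" by (simp add: t_def)
  have "norm (t *\<^sub>R v) = \<bar>B\<bar> + norm u + 1"
    using \<open>v \<noteq> 0\<close> by (simp add: t_def)
  moreover have "norm (t *\<^sub>R v) \<le> norm (u + t *\<^sub>R v) + norm u"
    using norm_triangle_ineq4[of "u + t *\<^sub>R v" u] by simp
  ultimately show False
    using B[OF ray[OF \<open>t \<ge> 0\<close>]] by linarith
qed

text \<open>For \<open>c = 0\<close> the solution lies in the recession cone, which the linear map sends to \<open>0\<close>
  because \<open>S\<close> is bounded.\<close>

lemma homogenized_solution:
  fixes S :: "(real^'n) set"
  assumes S: "S = {\<Sum>j<m. y j *\<^sub>R T j | y.
      (\<forall>i<r. (\<Sum>j<m. A i j * y j) \<le> b i) \<and> (\<forall>k<q. (\<Sum>j<m. C k j * y j) = d k)}"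
    and "bounded S" "S \<noteq> {}" "c \<ge> 0"
    and y: "\<forall>i<r. (\<Sum>j<m. A i j * y j) \<le> c * b i" "\<forall>k<q. (\<Sum>j<m. C k j * y j) = c * d k"
  shows "\<exists>s\<in>S. (\<Sum>j<m. y j *\<^sub>R T j) = c *\<^sub>R s"
proof (cases "c = 0")
  case True
  obtain y0 where
    y0: "\<forall>i<r. (\<Sum>j<m. A i j * y0 j) \<le> b i" "\<forall>k<q. (\<Sum>j<m. C k j * y0 j) = d k"
    and s: "(\<Sum>j<m. y0 j *\<^sub>R T j) \<in> S"
    using \<open>S \<noteq> {}\<close> unfolding S by blast
  have "(\<Sum>j<m. y0 j *\<^sub>R T j) + t *\<^sub>R (\<Sum>j<m. y j *\<^sub>R T j) \<in> S" if "t \<ge> 0" for t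
  proof -
    \<comment> \<open>As \<open>c = 0\<close>, \<open>y\<close> solves the homogeneous system, so
      adding a nonnegative multiple of it to \<open>y0\<close> stays feasible.\<close>
    let ?z = "\<lambda>j. y0 j + t * y j"
    have lin: "(\<Sum>j<m. a j * ?z j) = (\<Sum>j<m. a j * y0 j) + t * (\<Sum>j<m. a j * y j)" for a
      by (simp add: algebra_simps sum.distrib sum_distrib_left)
    have "(\<Sum>j<m. A i j * ?z j) \<le> b i" if "i < r" for i
      using y0(1) y(1) that True \<open>t \<ge> 0\<close> mult_nonneg_nonpos[of t "\<Sum>j<m. A i j * y j"]
      unfolding lin by fastforce
    moreover have "(\<Sum>j<m. C k j * ?z j) = d k" if "k < q" for k
      unfolding lin using y0(2) y(2) that True by simp
    moreover have "(\<Sum>j<m. y0 j *\<^sub>R T j) + t *\<^sub>R (\<Sum>j<m. y j *\<^sub>R T j) = (\<Sum>j<m. ?z j *\<^sub>R T j)"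
      by (simp add: algebra_simps sum.distrib scaleR_sum_right)
    ultimately show ?thesis
      unfolding S by (intro CollectI exI[of _ ?z] conjI allI impI) blast+
  qed
  then have "(\<Sum>j<m. y j *\<^sub>R T j) = 0"
    using bounded_ray_imp_zero[OF \<open>bounded S\<close>] by blast
  then show ?thesis using s True by auto
next
  case False
  \<comment> \<open>A positive multiplier can be divided out, which undoes the
    homogenization.\<close>
  let ?z = "\<lambda>j. y j / c"
  have "c > 0" using False \<open>c \<ge> 0\<close> by simp
  have lin: "(\<Sum>j<m. a j * ?z j) = (\<Sum>j<m. a j * y j) / c" for a
    by (simp add: sum_divide_distrib)
  have "\<forall>i<r. (\<Sum>j<m. A i j * ?z j) \<le> b i" "\<forall>k<q. (\<Sum>j<m. C k j * ?z j) = d k"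
    unfolding lin using y \<open>c > 0\<close> by (simp_all add: divide_le_eq mult.commute)
  then have "(\<Sum>j<m. ?z j *\<^sub>R T j) \<in> S"
    unfolding S by (intro CollectI exI[of _ ?z] conjI refl)
  moreover have "(\<Sum>j<m. y j *\<^sub>R T j) = c *\<^sub>R (\<Sum>j<m. ?z j *\<^sub>R T j)"
    using \<open>c > 0\<close> by (simp add: scaleR_sum_right)
  ultimately show ?thesis by blast
qed

text \<open>In the disjunctive formulation the variables are \<open>y (i, j)\<close> for \<open>j \<le> m i\<close>, the last one
  \<open>y (i, m i)\<close> being the multiplier of the \<open>i\<close>-th system. The normalization of the multipliers is
  repeated once for each \<open>i\<close>, as the equation with index \<open>(i, q i)\<close>.\<close>

lemma has_extended_formulation_convex_hull_Union:
  fixes S :: "'i \<Rightarrow> (real^'n) set"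
  assumes "finite I"
    and S: "\<And>i. i \<in> I \<Longrightarrow> convex (S i) \<and> bounded (S i) \<and> S i \<noteq> {}"
    and ef: "\<And>i. i \<in> I \<Longrightarrow> has_extended_formulation (S i) r"
  shows "has_extended_formulation (convex hull (\<Union>i\<in>I. S i)) (card I * (r + 1))"
proof (cases "I = {}")
  case True
  then show ?thesis using has_extended_formulation_empty by simp
next
  case False
  \<comment> \<open>Wrapping the description in one predicate keeps the simultaneous choice of seven
    witnesses for each \<open>i\<close> manageable.\<close>
  define sys where "sys S m A b C d q T \<longleftrightarrow> S = {\<Sum>j<m. y j *\<^sub>R T j | y.
      (\<forall>k<r. (\<Sum>j<m. A k j * y j) \<le> b k) \<and> (\<forall>k<q. (\<Sum>j<m. C k j * y j) = d k)}"
    for S m A b C d and q :: nat and T :: "nat \<Rightarrow> real^'n"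
  have "\<forall>i\<in>I. \<exists>m A b C d q T. sys (S i) m A b C d q T"
  proof
    fix i assume "i \<in> I"
    from has_extended_formulationE[OF ef[OF this]]
    show "\<exists>m A b C d q T. sys (S i) m A b C d q T"
      unfolding sys_def[symmetric] by metis
  qed
  then obtain m A b C d q T where
    "\<And>i. i \<in> I \<Longrightarrow> sys (S i) (m i) (A i) (b i) (C i) (d i) (q i) (T i)"
    by metis
  then have sys: "S i = {\<Sum>j<m i. y j *\<^sub>R T i j | y.
      (\<forall>k<r. (\<Sum>j<m i. A i k j * y j) \<le> b i k) \<and>
      (\<forall>k<q i. (\<Sum>j<m i. C i k j * y j) = d i k)}" if "i \<in> I" for i
    using that unfolding sys_def by simp
  let ?J = "SIGMA i:I. {..m i}"
  \<comment> \<open>The multipliers do not contribute to the projected point.\<close>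
  define T' where "T' = (\<lambda>(i, j). if j < m i then T i j else 0)"
  \<comment> \<open>Rows \<open>(i, k)\<close> with \<open>k < r\<close> are the homogenized
    inequalities with right-hand side moved to the left; row \<open>(i, r)\<close> says that the
    multiplier is nonnegative. This extra row accounts for the \<open>r + 1\<close> in the
    bound.\<close>
  define A' where "A' = (\<lambda>(i, k) (i', j). if i' = i then
      (if k < r then (if j < m i then A i k j else - b i k) else (if j < m i then 0 else - 1))
      else 0)"
  \<comment> \<open>In the normalizing row the column test refers to \<open>m i'\<close> and ignores
    whether \<open>i' = i\<close>, since the multipliers of all systems are summed.\<close>
  define C' where "C' = (\<lambda>(i, k) (i', j). if k < q i
      then (if i' = i then (if j < m i then C i k j else - d i k) else 0)
      else (if j < m i' then 0 else 1))"
  define d' where "d' = (\<lambda>(i, k). if k < q i then 0 else 1 :: real)"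
  have sumJ: "sum f ?J = (\<Sum>i\<in>I. (\<Sum>j<m i. f (i, j)) + f (i, m i))"
    for f :: "'i \<times> nat \<Rightarrow> 'z::comm_monoid_add"
    using \<open>finite I\<close> sum.Sigma[of I "\<lambda>i. {..m i}" "\<lambda>i j. f (i, j)"]
    by (simp add: lessThan_Suc_atMost[symmetric] add.commute)
  have sumT: "(\<Sum>p\<in>?J. y p *\<^sub>R T' p) = (\<Sum>i\<in>I. \<Sum>j<m i. y (i, j) *\<^sub>R T i j)" for y
    by (simp add: sumJ T'_def)
  have sumA: "(\<Sum>p\<in>?J. A' (i, k) p * y p) =
    (if k < r then (\<Sum>j<m i. A i k j * y (i, j)) - y (i, m i) * b i k else - y (i, m i))"
    if "i \<in> I" for i k y
  proof -
    have "(\<Sum>p\<in>?J. A' (i, k) p * y p) = (\<Sum>i'\<in>I. if i' = i then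
      (if k < r then (\<Sum>j<m i. A i k j * y (i, j)) - y (i, m i) * b i k else - y (i, m i)) else 0)"
      unfolding sumJ by (rule sum.cong) (auto simp: A'_def mult.commute)
    then show ?thesis using that \<open>finite I\<close> by simp
  qed
  have sumC: "(\<Sum>p\<in>?J. C' (i, k) p * y p) =
    (if k < q i then (\<Sum>j<m i. C i k j * y (i, j)) - y (i, m i) * d i k else (\<Sum>i\<in>I. y (i, m i)))"
    if "i \<in> I" for i k y
  proof (cases "k < q i")
    case True
    have "(\<Sum>p\<in>?J. C' (i, k) p * y p) = (\<Sum>i'\<in>I. if i' = i then
      (\<Sum>j<m i. C i k j * y (i, j)) - y (i, m i) * d i k else 0)"
      unfolding sumJ by (rule sum.cong) (use True in \<open>auto simp: C'_def mult.commute\<close>)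
    then show ?thesis using that True \<open>finite I\<close> by simp
  next
    case False
    then show ?thesis unfolding sumJ by (simp add: C'_def)
  qed
  have ball_Sigma: "(\<forall>p\<in>Sigma I B. Q p) \<longleftrightarrow> (\<forall>i\<in>I. \<forall>k\<in>B i. Q (i, k))"
    for Q and B :: "'i \<Rightarrow> nat set"
    by auto
  have ball_atMost: "(\<forall>k\<in>{..n}. Q k) \<longleftrightarrow> (\<forall>k<n. Q k) \<and> Q n" for Q and n :: nat
    by (auto simp: le_less)
  have ineqs: "(\<forall>p\<in>I \<times> {..r}. (\<Sum>p'\<in>?J. A' p p' * y p') \<le> 0) \<longleftrightarrow>
    (\<forall>i\<in>I. (\<forall>k<r. (\<Sum>j<m i. A i k j * y (i, j)) \<le> y (i, m i) * b i k) \<and> y (i, m i) \<ge> 0)" for y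
    by (auto simp: ball_Sigma ball_atMost sumA cong: ball_cong)
  \<comment> \<open>Here \<open>I\<close> must be nonempty: otherwise no copy of the normalization
    would be present.\<close>
  have eqs: "(\<forall>p\<in>(SIGMA i:I. {..q i}). (\<Sum>p'\<in>?J. C' p p' * y p') = d' p) \<longleftrightarrow>
    (\<forall>i\<in>I. \<forall>k<q i. (\<Sum>j<m i. C i k j * y (i, j)) = y (i, m i) * d i k) \<and>
    (\<Sum>i\<in>I. y (i, m i)) = 1" for y
    using False by (auto simp: ball_Sigma ball_atMost sumC d'_def cong: ball_cong)
  \<comment> \<open>By convexity one point from each set is enough; nonemptiness provides
    \<open>s i\<close> even where \<open>c i = 0\<close>.\<close>
  have hull: "convex hull (\<Union>i\<in>I. S i) = {\<Sum>i\<in>I. c i *\<^sub>R s i | c s.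
      (\<forall>i\<in>I. c i \<ge> 0) \<and> sum c I = 1 \<and> (\<forall>i\<in>I. s i \<in> S i)}"
    using convex_hull_finite_union[OF \<open>finite I\<close>, of S] S by simp
  have "has_extended_formulation (convex hull (\<Union>i\<in>I. S i)) (card (I \<times> {..r}))"
  proof (rule has_extended_formulationI[where J = ?J and K = "SIGMA i:I. {..q i}" and T = T'
        and A = A' and b = "\<lambda>_. 0" and C = C' and d = d'])
    show "convex hull (\<Union>i\<in>I. S i) = {\<Sum>p\<in>?J. y p *\<^sub>R T' p |y.
      (\<forall>p\<in>I \<times> {..r}. (\<Sum>p'\<in>?J. A' p p' * y p') \<le> 0) \<and>
      (\<forall>p\<in>(SIGMA i:I. {..q i}). (\<Sum>p'\<in>?J. C' p p' * y p') = d' p)}" (is "_ = ?R")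
    proof (intro equalityI subsetI)
      fix x assume "x \<in> convex hull (\<Union>i\<in>I. S i)"
      then obtain c s where x: "x = (\<Sum>i\<in>I. c i *\<^sub>R s i)" and c: "\<forall>i\<in>I. c i \<ge> 0" "sum c I = 1"
        and s: "\<forall>i\<in>I. s i \<in> S i"
        unfolding hull by blast
      have "\<forall>i\<in>I. \<exists>y. s i = (\<Sum>j<m i. y j *\<^sub>R T i j) \<and>
        (\<forall>k<r. (\<Sum>j<m i. A i k j * y j) \<le> b i k) \<and> (\<forall>k<q i. (\<Sum>j<m i. C i k j * y j) = d i k)"
        (is "\<forall>i\<in>I. ?sol i")
      proof
        fix i assume "i \<in> I"
        then have "s i \<in> S i" using s by blast
        then show "?sol i" unfolding sys[OF \<open>i \<in> I\<close>] by blast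
      qed
      from bchoice[OF this] obtain z where
        "\<forall>i\<in>I. s i = (\<Sum>j<m i. z i j *\<^sub>R T i j) \<and>
          (\<forall>k<r. (\<Sum>j<m i. A i k j * z i j) \<le> b i k) \<and>
          (\<forall>k<q i. (\<Sum>j<m i. C i k j * z i j) = d i k)"
        by blast
      then have z: "s i = (\<Sum>j<m i. z i j *\<^sub>R T i j)"
        "k < r \<Longrightarrow> (\<Sum>j<m i. A i k j * z i j) \<le> b i k"
        "k < q i \<Longrightarrow> (\<Sum>j<m i. C i k j * z i j) = d i k" if "i \<in> I" for i k
        using that by simp_all
      \<comment> \<open>Scaling a preimage of \<open>s i\<close> by \<open>c i\<close> solves the
        \<open>i\<close>-th homogenized system with multiplier \<open>c i\<close>.\<close>
      define y where "y = (\<lambda>(i, j). if j < m i then c i * z i j else c i)"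
      have lin: "(\<Sum>j<m i. a j * y (i, j)) = c i * (\<Sum>j<m i. a j * z i j)" for a i
        by (simp add: y_def sum_distrib_left mult.left_commute)
      have "x = (\<Sum>p\<in>?J. y p *\<^sub>R T' p)"
        unfolding sumT x by (simp add: y_def z(1) scaleR_sum_right)
      moreover have "\<forall>p\<in>I \<times> {..r}. (\<Sum>p'\<in>?J. A' p p' * y p') \<le> 0"
        unfolding ineqs lin using c z(2) by (simp add: y_def mult_left_mono)
      moreover have "\<forall>p\<in>(SIGMA i:I. {..q i}). (\<Sum>p'\<in>?J. C' p p' * y p') = d' p"
        unfolding eqs lin using c z(3) by (simp add: y_def)
      ultimately show "x \<in> ?R" by (intro CollectI exI[of _ y] conjI)
    next
      fix x assume "x \<in> ?R"
      then obtain y where x: "x = (\<Sum>i\<in>I. \<Sum>j<m i. y (i, j) *\<^sub>R T i j)"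
        and y: "\<And>i. i \<in> I \<Longrightarrow> \<forall>k<r. (\<Sum>j<m i. A i k j * y (i, j)) \<le> y (i, m i) * b i k"
          "\<And>i. i \<in> I \<Longrightarrow> y (i, m i) \<ge> 0"
          "\<And>i. i \<in> I \<Longrightarrow> \<forall>k<q i. (\<Sum>j<m i. C i k j * y (i, j)) = y (i, m i) * d i k"
          "(\<Sum>i\<in>I. y (i, m i)) = 1"
        unfolding sumT ineqs eqs by blast
      have "\<forall>i\<in>I. \<exists>s\<in>S i. (\<Sum>j<m i. y (i, j) *\<^sub>R T i j) = y (i, m i) *\<^sub>R s"
      proof
        fix i assume "i \<in> I"
        then show "\<exists>s\<in>S i. (\<Sum>j<m i. y (i, j) *\<^sub>R T i j) = y (i, m i) *\<^sub>R s"
          using S[of i] homogenized_solution[OF sys[of i] _ _ y(2)[of i] y(1)[of i] y(3)[of i]]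
          by blast
      qed
      then have "\<forall>i\<in>I. \<exists>s. s \<in> S i \<and> (\<Sum>j<m i. y (i, j) *\<^sub>R T i j) = y (i, m i) *\<^sub>R s"
        by blast
      from bchoice[OF this] obtain s where s: "\<forall>i\<in>I. s i \<in> S i"
        "\<forall>i\<in>I. (\<Sum>j<m i. y (i, j) *\<^sub>R T i j) = y (i, m i) *\<^sub>R s i"
        by blast
      have "x = (\<Sum>i\<in>I. y (i, m i) *\<^sub>R s i)"
        unfolding x using s(2) by simp
      then show "x \<in> convex hull (\<Union>i\<in>I. S i)"
        unfolding hull using s(1) y(2,4)
        by (intro CollectI exI[of _ "\<lambda>i. y (i, m i)"] exI[of _ s] conjI ballI) simp_all
    qed
  qed (use \<open>finite I\<close> in auto)
  then show ?thesis by (simp add: card_cartesian_product)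
qed

section \<open>Vertices of the cube and separating collections\<close>

text \<open>In each coordinate, 0 and 1 are endpoints of the interval [0,1], so a proper convex
  combination attaining one of them has both its ends there.\<close>

lemma cube_point_extreme:
  fixes x :: "real^'n"
  assumes "x \<in> cube_points"
  shows "x extreme_point_of cbox 0 1"
  unfolding extreme_point_of_def
proof (intro conjI ballI notI)
  have x: "x $ i = 0 \<or> x $ i = 1" for i
    using assms by (simp add: cube_points_def)
  show "x \<in> cbox 0 1"
    unfolding mem_box_cart using x by (metis order_refl zero_index one_index zero_le_one)
  fix a b :: "real^'n"
  assume ab: "a \<in> cbox 0 1" "b \<in> cbox 0 1" and "x \<in> open_segment a b"
  then obtain u where "a \<noteq> b" and u: "0 < u" "u < 1" "x = (1 - u) *\<^sub>R a + u *\<^sub>R b"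
    by (auto simp: in_segment)
  have "a $ i = b $ i" for i
  proof -
    have i: "0 \<le> a $ i" "a $ i \<le> 1" "0 \<le> b $ i" "b $ i \<le> 1"
      using ab by (auto simp: mem_box_cart)
    have e: "x $ i = (1 - u) * a $ i + u * b $ i" by (simp add: u(3))
    show ?thesis
    proof (cases "x $ i = 0")
      case True
      moreover have "(1 - u) * a $ i \<ge> 0" "u * b $ i \<ge> 0" using i u by simp_all
      ultimately have "(1 - u) * a $ i = 0" "u * b $ i = 0" using e by linarith+
      then show ?thesis using u by simp
    next
      \<comment> \<open>The coordinate is 1; the reflection t \<mapsto> 1 - t reduces this to the
        argument for 0.\<close>
      case False
      then have "(1 - u) * (1 - a $ i) + u * (1 - b $ i) = 0"
        using x[of i] e by (simp add: algebra_simps)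
      moreover have "(1 - u) * (1 - a $ i) \<ge> 0" "u * (1 - b $ i) \<ge> 0" using i u by simp_all
      ultimately have "(1 - u) * (1 - a $ i) = 0" "u * (1 - b $ i) = 0" by linarith+
      then show ?thesis using u by simp
    qed
  qed
  then show False using \<open>a \<noteq> b\<close> by (simp add: vec_eq_iff)
qed

text \<open>The cube is a polytope, so it has only finitely many extreme points.\<close>

lemma finite_cube_points: "finite (cube_points :: (real^'n) set)"
proof (rule finite_subset)
  show "cube_points \<subseteq> {x :: real^'n. x extreme_point_of cbox 0 1}"
    using cube_point_extreme by blast
  show "finite {x :: real^'n. x extreme_point_of cbox 0 1}"
    by (simp add: finite_polyhedron_extreme_points polytope_imp_polyhedron polytope_interval)
qed

lemma minimal_separating:
  fixes X :: "(real^'n) set"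
  obtains \<F> where "finite \<F>" "separating X \<F>" "card \<F> = sep_number X"
proof -
  let ?\<F> = "(\<lambda>x. {x}) ` (cube_points - X)"
  have "finite ?\<F>" using finite_cube_points by blast
  moreover have "separating X ?\<F>"
    unfolding separating_def using cube_point_extreme by (auto simp: face_of_singleton)
  ultimately have "\<exists>k \<F>. finite \<F> \<and> separating X \<F> \<and> card \<F> = k" by blast
  from LeastI_ex[OF this] show ?thesis
    unfolding sep_number_def[symmetric] using that by blast
qed

section \<open>The bound for forbidden vertices\<close>

theorem proposition17:
  fixes P X :: "(real^'n) set"
  assumes "zero_one_polytope P"
    and "X \<subseteq> vert P"
    and "X \<noteq> {}"
  shows "xc (forb P X) \<le> sep_number X * (xc P + 1)"
proof -
  have P: "polytope P" "vert P \<subseteq> cube_points"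
    using assms(1) by (auto simp: zero_one_polytope_def)
  have cp: "compact P" "convex P"
    using P(1) by (auto simp: polytope_imp_compact polytope_imp_convex)
  obtain \<F> where \<F>: "finite \<F>" "separating X \<F>" "card \<F> = sep_number X"
    by (rule minimal_separating)
  have face: "F face_of cbox 0 1" if "F \<in> \<F>" for F
    using \<F>(2) that by (simp add: separating_def)
  have "P = convex hull (vert P)"
    unfolding vert_def using Krein_Milman_Minkowski[OF cp] .
  also have "\<dots> \<subseteq> cbox 0 1"
    using P(2) cube_point_extreme by (intro hull_minimal) (auto simp: extreme_point_of_def)
  finally have sub: "P \<subseteq> cbox 0 1" .
  have hull: "F \<inter> P = convex hull (F \<inter> vert P)" and cpF: "convex (F \<inter> P)" "bounded (F \<inter> P)"
    and ef: "has_extended_formulation (F \<inter> P) (xc P)" if "F \<in> \<F>" for F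
  proof -
    \<comment> \<open>A face of the cube cuts a face out of the convex subset \<open>P\<close>, so
      the vertices of \<open>F \<inter> P\<close> are the vertices of \<open>P\<close> lying in
      \<open>F\<close>.\<close>
    have "F \<inter> P face_of cbox 0 1 \<inter> P"
      using face_of_slice[OF face[OF that] cp(2)] .
    moreover have "cbox 0 1 \<inter> P = P" using sub by blast
    ultimately have f: "F \<inter> P face_of P" by simp
    then show "convex (F \<inter> P)" by (rule face_of_imp_convex)
    have "compact (F \<inter> P)" using face_of_imp_compact[OF cp(2,1) f] .
    then show "bounded (F \<inter> P)" by (rule compact_imp_bounded)
    have "{x. x extreme_point_of F \<inter> P} = F \<inter> vert P"
      using extreme_point_of_face[OF f] by (auto simp: vert_def extreme_point_of_def)
    then show "F \<inter> P = convex hull (F \<inter> vert P)"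
      using Krein_Milman_Minkowski[OF \<open>compact (F \<inter> P)\<close> \<open>convex (F \<inter> P)\<close>] by simp
    \<comment> \<open>Within a convex set a face is cut out by its affine hull, so passing from
      \<open>P\<close> to \<open>F \<inter> P\<close> adds equations only.\<close>
    have "F = affine hull F \<inter> cbox 0 1"
      using face_of_imp_eq_affine_Int[OF _ face[OF that]] by simp
    then have "F \<inter> P = P \<inter> affine hull F" using sub by blast
    moreover have "has_extended_formulation P (xc P)"
      unfolding xc_def using polytope_has_extended_formulation[OF P(1)] by (rule LeastI_ex)
    ultimately show "has_extended_formulation (F \<inter> P) (xc P)"
      using has_extended_formulation_Int_affine_hull by simp
  qed
  \<comment> \<open>Faces missing \<open>P\<close> are discarded because the disjunctive formulation
    needs nonempty sets; this can only lower the count.\<close>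
  define I where "I = {F \<in> \<F>. F \<inter> P \<noteq> {}}"
  \<comment> \<open>Vertices of \<open>P\<close> are 0/1 points, so the separating collection covers
    exactly those outside \<open>X\<close>; the discarded faces contain none of them.\<close>
  have "vert P \<subseteq> P" by (auto simp: vert_def extreme_point_of_def)
  then have "vert P - X = (\<Union>F\<in>I. F \<inter> vert P)"
    using \<F>(2) P(2) unfolding separating_def I_def by blast
  then have "forb P X = convex hull (\<Union>F\<in>I. F \<inter> vert P)"
    by (simp add: forb_def)
  also have "\<dots> = convex hull (\<Union>F\<in>I. F \<inter> P)"
  proof
    show "convex hull (\<Union>F\<in>I. F \<inter> vert P) \<subseteq> convex hull (\<Union>F\<in>I. F \<inter> P)"
      using \<open>vert P \<subseteq> P\<close> by (intro hull_mono) blast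
    have "F \<inter> P \<subseteq> convex hull (\<Union>F\<in>I. F \<inter> vert P)" if "F \<in> I" for F
    proof -
      have "F \<inter> P = convex hull (F \<inter> vert P)"
        using that by (intro hull) (simp add: I_def)
      also have "\<dots> \<subseteq> convex hull (\<Union>F\<in>I. F \<inter> vert P)"
        using that by (intro hull_mono) blast
      finally show ?thesis .
    qed
    then show "convex hull (\<Union>F\<in>I. F \<inter> P) \<subseteq> convex hull (\<Union>F\<in>I. F \<inter> vert P)"
      by (intro hull_minimal) auto
  qed
  finally have forb: "forb P X = convex hull (\<Union>F\<in>I. F \<inter> P)" .
  have "has_extended_formulation (forb P X) (card I * (xc P + 1))"
    unfolding forb
  proof (rule has_extended_formulation_convex_hull_Union)
    show "finite I" using \<F>(1) by (simp add: I_def)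
    fix F assume "F \<in> I"
    then have F: "F \<in> \<F>" "F \<inter> P \<noteq> {}" by (auto simp: I_def)
    show "convex (F \<inter> P) \<and> bounded (F \<inter> P) \<and> F \<inter> P \<noteq> {}"
      using cpF[OF F(1)] F(2) by (intro conjI)
    show "has_extended_formulation (F \<inter> P) (xc P)"
      by (rule ef[OF F(1)])
  qed
  then have "xc (forb P X) \<le> card I * (xc P + 1)"
    unfolding xc_def by (rule Least_le)
  also have "\<dots> \<le> sep_number X * (xc P + 1)"
    unfolding \<F>(3)[symmetric] I_def using \<F>(1) by (intro mult_right_mono card_mono) auto
  finally show ?thesis .
qed

end
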